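(* The equation \[ (2^{k}-1)(3^{k}-1)=x^{n} \] has no solution in positive integers $k, x, n$ with $n>2$. *)

theory Defs
  imports Main
begin

end

theory Submission
  imports Defs "HOL-Number_Theory.Number_Theory"
begin

text \<open>
  By strong induction, every positive \<open>m \<le> n\<close> divides \<open>k\<close>. For a prime \<open>p \<ge> 5\<close> with
  \<open>p \<le> m\<close>, the induction hypothesis gives \<open>p - 1\<close> dividing \<open>k\<close>, so \<open>p\<close> divides the
  left-hand side and, by lifting the exponent, \<open>n \<le> S + 2 v\<^sub>p(k)\<close>, where \<open>S\<close> is the
  \<open>p\<close>-adic valuation of \<open>(2^(p-1) - 1) (3^(p-1) - 1) < 6^(p-1) \<le> p^p\<close>. Hence \<open>S < p\<close>,
  which forces \<open>v\<^sub>p(k) \<ge> a\<close> whenever \<open>p^a \<le> n\<close>; the primes 2 and 3 are similar.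
  In particular \<open>n\<close> divides \<open>k\<close>, so \<open>6^k\<close> is an \<open>n\<close>-th power, and for \<open>n > 2\<close> the
  left-hand side is too close below \<open>6^k\<close> to be another one.
\<close>

section \<open>Lifting the exponent\<close>

text \<open>In the binomial expansion, all terms of degree at least two in \<open>p * c\<close>
  vanish modulo \<open>p ^ 2\<close>.\<close>

lemma power_cong_linear:
  fixes p c :: int
  shows "[(1 + p * c) ^ i = 1 + of_nat i * (p * c)] (mod p ^ 2)"
proof (induction i)
  case (Suc i)
  have "[(1 + p * c) * (1 + p * c) ^ i = (1 + p * c) * (1 + of_nat i * (p * c))] (mod p ^ 2)"
    using Suc.IH by (rule cong_scalar_left)
  also have "(1 + p * c) * (1 + of_nat i * (p * c))
      = 1 + of_nat (Suc i) * (p * c) + p ^ 2 * (of_nat i * c ^ 2)"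
    by (simp add: algebra_simps power2_eq_square)
  also have "[\<dots> = 1 + of_nat (Suc i) * (p * c)] (mod p ^ 2)"
    by (simp add: cong_iff_dvd_diff)
  finally show ?case by simp
qed simp

text \<open>With \<open>b = 1 + p * c\<close>, the sum is
  \<open>p + p * c * (0 + ... + (p - 1))\<close> modulo \<open>p ^ 2\<close>. The second term
  vanishes: for odd \<open>p\<close> because \<open>p\<close> divides the inner sum, for
  \<open>p = 2\<close> because \<open>4 dvd b - 1\<close> makes \<open>c\<close> even.\<close>

lemma multiplicity_geometric_sum_prime:
  fixes p :: nat and b :: int
  assumes p: "prime p" and dvd: "int p dvd b - 1" and two: "p = 2 \<longrightarrow> 4 dvd b - 1"
  shows "multiplicity (int p) (\<Sum>i<p. b ^ i) = 1"
proof -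
  obtain c where c: "b - 1 = int p * c" using dvd by blast
  then have b: "b = 1 + int p * c" by simp
  have gauss: "2 * (\<Sum>i<p. int i) = int p * (int p - 1)"
    by (induction p) (simp_all add: algebra_simps)
  have "int p dvd c * (\<Sum>i<p. int i)"
  proof (cases "p = 2")
    case True
    with two c have "2 dvd c" by auto
    with True show ?thesis by simp
  next
    case False
    then have "coprime (int p) 2"
      using p by (metis int_ops(3) coprime_int_iff primes_coprime two_is_prime_nat)
    moreover have "int p dvd 2 * (\<Sum>i<p. int i)" unfolding gauss by simp
    ultimately show ?thesis by (simp add: coprime_dvd_mult_right_iff)
  qed
  then have "int p * int p dvd int p * (c * (\<Sum>i<p. int i))"
    by (rule mult_dvd_mono[OF dvd_refl])
  also have "\<dots> = (\<Sum>i<p. int i * (int p * c))"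
    by (simp add: sum_distrib_left mult_ac)
  finally have "int p ^ 2 dvd (\<Sum>i<p. int i * (int p * c))"
    by (simp add: power2_eq_square)
  then have "[(\<Sum>i<p. 1 + int i * (int p * c)) = int p] (mod int p ^ 2)"
    by (simp add: sum.distrib cong_iff_dvd_diff)
  moreover have "[(\<Sum>i<p. b ^ i) = (\<Sum>i<p. 1 + int i * (int p * c))] (mod int p ^ 2)"
    unfolding b by (intro cong_sum power_cong_linear)
  ultimately have "[(\<Sum>i<p. b ^ i) = int p] (mod int p ^ 2)"
    using cong_trans by blast
  then obtain d where "(\<Sum>i<p. b ^ i) - int p = int p ^ 2 * d"
    by (auto simp: cong_iff_dvd_diff)
  then have d: "(\<Sum>i<p. b ^ i) = int p * (1 + int p * d)"
    by (simp add: algebra_simps power2_eq_square)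
  have p1: "\<not> is_unit (int p)" "int p \<noteq> 0" using p by auto
  have "\<not> int p dvd 1 + int p * d"
    using p1 by (metis dvd_add_left_iff dvd_triv_left)
  then show ?thesis
    unfolding d using p1 by (intro multiplicity_eqI) (auto simp: power2_eq_square)
qed

text \<open>Induction on \<open>j\<close>: each factor \<open>p\<close> of \<open>j\<close> splits
  off a geometric sum of multiplicity one. Once \<open>p\<close> no longer divides \<open>j\<close>,
  the remaining sum is congruent to \<open>j\<close> modulo \<open>p\<close>, hence prime to
  \<open>p\<close>.\<close>

lemma multiplicity_power_diff_1:
  fixes p j :: nat and b :: int
  assumes p: "prime p" and b: "b > 1" and j: "j > 0"
    and dvd: "int p dvd b - 1" and two: "p = 2 \<longrightarrow> 4 dvd b - 1"
  shows "multiplicity (int p) (b ^ j - 1) = multiplicity (int p) (b - 1) + multiplicity p j"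
  using j
proof (induction j rule: less_induct)
  case (less j)
  have p': "prime_elem (int p)" using p by auto
  have pos: "b ^ i - 1 \<noteq> 0" if "i > 0" for i
    using that b by (metis one_less_power less_irrefl right_minus_eq)
  have dvd_pow: "b - 1 dvd b ^ i - 1" for i
    using power_diff_1_eq[of b i] by simp
  have geom: "b ^ (i * l) - 1 = (b ^ i - 1) * (\<Sum>s<l. (b ^ i) ^ s)" for i l
    using power_diff_1_eq[of "b ^ i" l] by (simp add: power_mult)
  show ?case
  proof (cases "p dvd j")
    case True
    then obtain i where i: "j = i * p" by (metis dvd_div_mult_self)
    have "i > 0" "i < j" using i less.prems prime_gt_1_nat[OF p] by auto
    have sum1: "multiplicity (int p) (\<Sum>s<p. (b ^ i) ^ s) = 1"
      using p dvd two dvd_pow[of i]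
      by (intro multiplicity_geometric_sum_prime) (auto intro: dvd_trans)
    have "multiplicity (int p) (b ^ j - 1) = multiplicity (int p) (b ^ i - 1) + 1"
      using pos[of j] less.prems
      unfolding i geom sum1[symmetric]
      by (intro prime_elem_multiplicity_mult_distrib p') auto
    also have "\<dots> = multiplicity (int p) (b - 1) + (multiplicity p i + 1)"
      using less.IH[of i] \<open>i > 0\<close> \<open>i < j\<close> by simp
    also have "multiplicity p i + 1 = multiplicity p j"
      using p \<open>i > 0\<close> unfolding i
      by (subst prime_elem_multiplicity_mult_distrib) auto
    finally show ?thesis .
  next
    case False
    have "[b = 1] (mod int p)" using dvd by (simp add: cong_iff_dvd_diff)
    then have "[(\<Sum>s<j. b ^ s) = (\<Sum>s<j. 1 ^ s)] (mod int p)"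
      by (intro cong_sum cong_pow)
    then have "[(\<Sum>s<j. b ^ s) = int j] (mod int p)" by simp
    then have "\<not> int p dvd (\<Sum>s<j. b ^ s)"
      using False by (simp add: cong_dvd_iff)
    moreover have "b ^ j - 1 = (b - 1) * (\<Sum>s<j. b ^ s)"
      using geom[of 1 j] by simp
    ultimately show ?thesis
      using False pos[of j] less.prems
      by (auto simp: prime_elem_multiplicity_mult_distrib[OF p'] not_dvd_imp_multiplicity_0)
  qed
qed

section \<open>Divisors of the exponent\<close>

text \<open>Equality holds at \<open>a = 1\<close>; raising \<open>a\<close> by one adds at least
  \<open>q ^ a\<close>, hence at least 2, to the right-hand side.\<close>

lemma add_two_mult_le_power_add_two:
  fixes q a :: nat
  assumes "q \<ge> 2" "a > 0"
  shows "q + 2 * a \<le> q ^ a + 2"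
  using assms(2)
proof (induction a rule: nat_induct_non_zero)
  case (Suc a)
  have double: "2 * q ^ a \<le> q * q ^ a" using assms(1) by (intro mult_right_mono) auto
  have "q \<le> q ^ a"
    using assms(1) Suc.hyps by (intro self_le_power) auto
  with double have "q + 2 * Suc a \<le> 2 * q ^ a + 2"
    using Suc.IH assms(1) by (simp del: One_nat_def)
  also have "\<dots> \<le> q * q ^ a + 2" using double by (rule add_right_mono)
  finally show ?case by simp
qed simp

lemma six_power_le_power_self:
  fixes p :: nat
  assumes "p \<ge> 5"
  shows "6 ^ (p - 1) \<le> p ^ p"
  using assms
proof (cases "p = 5")
  case False
  with assms have "6 ^ (p - 1) \<le> p ^ (p - 1)" by (intro power_mono) auto
  also have "\<dots> \<le> p ^ p" using assms by (intro power_increasing) auto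
  finally show ?thesis .
qed simp

lemma fermat_int:
  fixes p a :: nat
  assumes "prime p" "\<not> p dvd a"
  shows "int p dvd int a ^ (p - 1) - 1"
  using fermat_theorem[OF assms]
  by (simp add: cong_iff_dvd_diff flip: cong_int_iff)

lemma multiplicity_exponent_ge:
  fixes k n p a :: nat and x :: int
  assumes k: "k > 0" and n: "n > 2" and eq: "(2 ^ k - 1) * (3 ^ k - 1) = x ^ n"
    and p: "prime p" and a: "a > 0" "p ^ a \<le> n" and pk: "(p - 1) dvd k"
  shows "a \<le> multiplicity p k"
proof -
  have p2: "p \<ge> 2" using p by (rule prime_ge_2_nat)
  have gt: "(c::int) ^ i > 1" if "c > 1" "i > 0" for c i
    using that by (rule one_less_power)
  have nz: "(2::int) ^ k - 1 \<noteq> 0" "(3::int) ^ k - 1 \<noteq> 0"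
    using gt[of 2 k] gt[of 3 k] k by auto
  \<comment> \<open>A prime dividing the product divides \<open>x\<close>, so it occurs at least
    \<open>n\<close> times in \<open>x ^ n\<close>.\<close>
  have n_le: "n \<le> multiplicity (int q) (2 ^ k - 1) + multiplicity (int q) (3 ^ k - 1)"
    if q: "prime q" and "int q dvd (2 ^ k - 1) * (3 ^ k - 1)" for q :: nat
  proof -
    have q': "prime_elem (int q)" using q by auto
    have "int q dvd x"
      using that eq q' prime_elem_dvd_power by metis
    moreover have "x \<noteq> 0" using eq nz n by (auto simp: power_0_left)
    ultimately have "multiplicity (int q) x \<ge> 1"
      by (intro multiplicity_geI) (use q in auto)
    moreover have "multiplicity (int q) (2 ^ k - 1) + multiplicity (int q) (3 ^ k - 1)
        = n * multiplicity (int q) x"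
      using prime_elem_multiplicity_mult_distrib[OF q' nz]
        prime_elem_multiplicity_power_distrib[OF q' \<open>x \<noteq> 0\<close>, of n] eq by simp
    ultimately show ?thesis by simp
  qed
  have odd2: "odd ((2::int) ^ k - 1)" using k by simp
  have even3: "even ((3::int) ^ k - 1)" by simp
  have n_le2: "n \<le> multiplicity 2 ((3::int) ^ k - 1)"
    using n_le[of 2] odd2 even3 by (simp add: not_dvd_imp_multiplicity_0)
  \<comment> \<open>For odd \<open>k\<close>, \<open>3 ^ k - 1\<close> is 2 modulo 4, but all
    \<open>n > 2\<close> factors 2 must come from it.\<close>
  have "even k"
  proof (rule ccontr)
    assume "odd k"
    then obtain i where "k = 2 * i + 1" by (rule oddE)
    then have "(3::int) ^ k = 3 * 9 ^ i" by (simp add: power_mult)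
    moreover have "[(9::int) ^ i = 1 ^ i] (mod 4)"
      by (rule cong_pow) (simp add: cong_def)
    then have "(9::int) ^ i mod 4 = 1" by (simp add: cong_def)
    ultimately have "\<not> 4 dvd (3::int) ^ k - 1" by presburger
    moreover have "(2::int) ^ 2 dvd 3 ^ k - 1"
      using n_le2 n by (intro multiplicity_dvd') simp
    ultimately show False by simp
  qed
  then obtain h where h: "k = 2 * h" by blast
  have "h > 0" using h k by simp
  \<comment> \<open>Passing from \<open>k div d\<close> to \<open>k\<close> can only raise the
    valuation, so an inequality remains. It is used with \<open>d = 2\<close> for
    \<open>p = 3\<close> and with \<open>d = p - 1\<close> for \<open>p \<ge> 5\<close>.\<close>
  have lift: "multiplicity (int p) (c ^ k - 1) \<le> multiplicity (int p) (c ^ d - 1) + multiplicity p k"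
    if "c > 1" "d > 0" "d dvd k" "int p dvd c ^ d - 1" "p = 2 \<longrightarrow> 4 dvd c ^ d - 1" for c :: int and d
  proof -
    obtain j where j: "k = d * j" using \<open>d dvd k\<close> by blast
    have "c ^ k - 1 = (c ^ d) ^ j - 1" by (simp add: j power_mult)
    moreover have "multiplicity p j \<le> multiplicity p k"
      using j k by (intro dvd_imp_multiplicity_le) auto
    ultimately show ?thesis
      using multiplicity_power_diff_1[of p "c ^ d" j] p gt[of c d] that j k by simp
  qed
  consider "p = 2" | "p = 3" | "p \<ge> 5"
  proof -
    have "p \<noteq> 4" using p by auto
    then show ?thesis using that p2 by linarith
  qed
  then show ?thesis
  proof cases
    case 1
    \<comment> \<open>The base is 9 rather than 3, since lifting at 2 requires 4 to divide the base
      minus one.\<close>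
    have "multiplicity 2 ((3::int) ^ k - 1) = multiplicity 2 (8::int) + multiplicity 2 h"
      using multiplicity_power_diff_1[of 2 9 h] \<open>h > 0\<close> by (simp add: h power_mult)
    also have "multiplicity 2 (8::int) = 3"
      by (rule multiplicity_eqI) auto
    finally have "n \<le> 3 + multiplicity 2 h" using n_le2 by simp
    moreover have "multiplicity 2 k = 1 + multiplicity 2 h"
      unfolding h using \<open>h > 0\<close> by (subst prime_elem_multiplicity_mult_distrib) auto
    \<comment> \<open>\<open>2 ^ a\<close> is at least \<open>a + 2\<close> only from
      \<open>a = 2\<close> on; for \<open>a = 1\<close> the bound is \<open>n > 2\<close>
      itself.\<close>
    moreover have "a + 2 \<le> n"
    proof (cases "a = 1")
      case False
      have "a + 2 \<le> 2 ^ a" if "a \<ge> 2" for a :: nat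
        using that by (induction a rule: nat_induct_at_least) auto
      from this[of a] False a 1 show ?thesis by simp
    qed (use n in simp)
    ultimately show ?thesis using 1 by simp
  next
    case 2
    have "multiplicity 3 ((2::int) ^ k - 1) \<le> multiplicity 3 (3::int) + multiplicity 3 k"
      using lift[of 2 2] \<open>even k\<close> 2 by simp
    moreover have "(3::int) dvd 3 ^ k" using k by simp
    then have "\<not> (3::int) dvd 3 ^ k - 1" by presburger
    then have "multiplicity 3 ((3::int) ^ k - 1) = 0" by (rule not_dvd_imp_multiplicity_0)
    moreover have "(3::int) dvd 2 ^ k - 1"
      using power_diff_1_eq[of "4::int" h] by (simp add: h power_mult)
    ultimately have "n \<le> 1 + multiplicity 3 k"
      using n_le[of 3] by simp
    moreover have "a < 3 ^ a" by (rule less_exp[THEN less_le_trans]) (simp add: power_mono)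
    ultimately show ?thesis using a 2 by simp
  next
    case 3
    define S where "S = multiplicity (int p) (2 ^ (p - 1) - 1) + multiplicity (int p) (3 ^ (p - 1) - 1)"
    have "\<not> p dvd 2" "\<not> p dvd 3"
      using 3 by (auto dest: dvd_imp_le)
    then have dvd2: "int p dvd 2 ^ (p - 1) - 1" and dvd3: "int p dvd 3 ^ (p - 1) - 1"
      using fermat_int[OF p, of 2] fermat_int[OF p, of 3] by simp_all
    have "p - 1 > 0" using 3 by simp
    have "int p dvd 2 ^ k - 1"
    proof -
      obtain j where "k = (p - 1) * j" using pk by blast
      then show ?thesis
        using dvd2 power_diff_1_eq[of "(2::int) ^ (p - 1)" j] by (simp add: power_mult)
    qed
    then have "n \<le> multiplicity (int p) (2 ^ k - 1) + multiplicity (int p) (3 ^ k - 1)"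
      using n_le[OF p] by simp
    also have "\<dots> \<le> S + 2 * multiplicity p k"
      using lift[OF _ \<open>p - 1 > 0\<close> pk dvd2] lift[OF _ \<open>p - 1 > 0\<close> pk dvd3] 3
      by (simp add: S_def)
    finally have n_le_S: "n \<le> S + 2 * multiplicity p k" .
    have "int p ^ S \<le> (2 ^ (p - 1) - 1) * (3 ^ (p - 1) - 1)"
      unfolding S_def power_add using gt[of 2 "p - 1"] gt[of 3 "p - 1"] \<open>p - 1 > 0\<close>
      by (intro mult_mono zdvd_imp_le[OF multiplicity_dvd]) auto
    also have "\<dots> < 2 ^ (p - 1) * 3 ^ (p - 1)"
      using gt[of 2 "p - 1"] gt[of 3 "p - 1"] \<open>p - 1 > 0\<close>
      by (intro mult_strict_mono) auto
    also have "\<dots> = int (6 ^ (p - 1))" by (simp flip: power_mult_distrib)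
    also have "\<dots> \<le> int (p ^ p)" using six_power_le_power_self[OF 3] by (simp only: of_nat_le_iff)
    finally have "int (p ^ S) < int (p ^ p)" by simp
    then have "S < p"
      using p2 power_strict_increasing_iff[of p S p] by (simp only: of_nat_less_iff)
    \<comment> \<open>If the valuation were at most \<open>a - 1\<close>, then
      \<open>n \<le> (p - 1) + 2 * (a - 1) < p + 2 * a - 2 \<le> p ^ a\<close>, against
      \<open>p ^ a \<le> n\<close>.\<close>
    then show ?thesis
      using n_le_S add_two_mult_le_power_add_two[of p a] p2 a by linarith
  qed
qed

lemma dvd_exponent_of_le:
  fixes k n m :: nat and x :: int
  assumes k: "k > 0" and n: "n > 2" and eq: "(2 ^ k - 1) * (3 ^ k - 1) = x ^ n"
    and m: "m > 0" "m \<le> n"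
  shows "m dvd k"
  using m
proof (induction m rule: less_induct)
  case (less m)
  show ?case
  proof (rule multiplicity_le_imp_dvd)
    fix p :: nat
    assume p: "prime p"
    show "multiplicity p m \<le> multiplicity p k"
    proof (cases "p dvd m")
      case True
      have "p \<le> m" using True less.prems by (auto intro: dvd_imp_le)
      \<comment> \<open>Since \<open>0 < p - 1 < m\<close>, the induction hypothesis supplies the
        divisibility that Fermat's theorem needs.\<close>
      have "(p - 1) dvd k"
        using less.IH[of "p - 1"] less.prems \<open>p \<le> m\<close> prime_ge_2_nat[OF p] by auto
      moreover have "multiplicity p m > 0"
        using True p less.prems by (simp add: prime_multiplicity_gt_zero_iff)
      moreover have "p ^ multiplicity p m \<le> n"
        using less.prems multiplicity_dvd[of p m] by (meson dvd_imp_le le_trans)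
      ultimately show ?thesis using multiplicity_exponent_ge[OF k n eq p] by blast
    qed (simp add: not_dvd_imp_multiplicity_0)
  qed (use less.prems in auto)
qed

section \<open>Size comparison\<close>

text \<open>With \<open>y = 6 ^ t\<close> and \<open>y ^ n = 6 ^ k\<close>, a smaller
  \<open>n\<close>-th power lies below \<open>y ^ n\<close> by at least \<open>y ^ (n - 1)\<close>,
  whereas the actual gap is only \<open>2 ^ k + 3 ^ k - 1\<close>.\<close>

lemma not_perfect_power_if_dvd_exponent:
  fixes k n :: nat and x :: int
  assumes k: "k > 0" and n: "n > 2" and x: "x > 0" and dvd: "n dvd k"
  shows "(2 ^ k - 1) * (3 ^ k - 1) \<noteq> x ^ n"
proof
  assume eq: "(2 ^ k - 1) * (3 ^ k - 1) = x ^ n"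
  obtain t where t: "k = n * t" using dvd by blast
  have "t > 0" using t k by (cases t) auto
  define y :: int where "y = 6 ^ t"
  have y: "y > 1" unfolding y_def using \<open>t > 0\<close> by simp
  have yn: "y ^ n = 2 ^ k * 3 ^ k"
    by (simp add: y_def t mult.commute flip: power_mult power_mult_distrib)
  have gt: "(2::int) ^ k > 1" "(3::int) ^ k > 1" using k by simp_all
  have "x ^ n < y ^ n"
    unfolding eq[symmetric] yn using gt by (intro mult_strict_mono) auto
  then have "x < y" by (rule power_less_imp_less_base) (use y in simp)
  \<comment> \<open>The gap estimate is multiplied by \<open>y\<close> to avoid the exponent
    \<open>n - 1\<close>.\<close>
  have "y * x ^ n \<le> y ^ n * (y - 1)"
  proof -
    have "x ^ n = x * x ^ (n - 1)" using n by (cases n) auto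
    also have "\<dots> \<le> (y - 1) * y ^ (n - 1)"
      using \<open>x < y\<close> x by (intro mult_mono power_mono) auto
    finally have "y * x ^ n \<le> y * ((y - 1) * y ^ (n - 1))" using y by simp
    also have "\<dots> = y ^ n * (y - 1)" using n by (cases n) auto
    finally show ?thesis .
  qed
  then have upper: "y ^ n + y \<le> y * (2 ^ k + 3 ^ k)"
    unfolding eq[symmetric] yn by (simp add: algebra_simps)
  \<comment> \<open>Here \<open>n > 2\<close> enters: it allows comparing \<open>6 ^ t\<close> with
    \<open>8 ^ t\<close> and \<open>27 ^ t\<close>.\<close>
  have tk: "3 * t \<le> k" using t n by simp
  \<comment> \<open>The constants give \<open>y \<le> 3/4 * 2 ^ k\<close> and
    \<open>y \<le> 1/4 * 3 ^ k\<close>, with weights summing to one. At \<open>t = 1\<close> they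
    read \<open>24 \<le> 24\<close> and \<open>24 \<le> 27\<close>.\<close>
  have y8: "4 * y \<le> 3 * 8 ^ t" unfolding y_def using \<open>t > 0\<close>
    by (induction t rule: nat_induct_non_zero) auto
  have y27: "4 * y \<le> 27 ^ t" unfolding y_def using \<open>t > 0\<close>
  proof (induction t rule: nat_induct_non_zero)
    case (Suc t)
    moreover have "(0::int) < 6 ^ t" by simp
    ultimately show ?case unfolding power_Suc by linarith
  qed simp
  have "(8::int) ^ t = 2 ^ (3 * t)" "(27::int) ^ t = 3 ^ (3 * t)"
    by (simp_all add: power_mult)
  then have "(8::int) ^ t \<le> 2 ^ k" "(27::int) ^ t \<le> 3 ^ k"
    using tk by (simp_all add: power_increasing)
  with y8 y27 have le: "4 * y \<le> 3 * 2 ^ k" "4 * y \<le> 3 ^ k" by linarith+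
  have pos: "(0::int) < 2 ^ k" "(0::int) < 3 ^ k" by simp_all
  have "4 * (y * 3 ^ k) \<le> 3 * (2 ^ k * 3 ^ k)"
    using mult_right_mono[OF le(1) less_imp_le[OF pos(2)]]
    by (simp only: mult.assoc)
  moreover have "4 * (y * 2 ^ k) \<le> 2 ^ k * 3 ^ k"
    using mult_left_mono[OF le(2) less_imp_le[OF pos(1)]]
    by (simp only: mult_ac)
  ultimately have "y * (2 ^ k + 3 ^ k) \<le> y ^ n" unfolding yn distrib_left by linarith
  with upper y show False by linarith
qed

theorem theorem1:
  shows "\<not> (\<exists>(k::nat) (x::int) (n::nat). k > 0 \<and> x > 0 \<and> n > 2 \<and>
           (2 ^ k - 1) * (3 ^ k - 1) = x ^ n)"
proof (intro notI, elim exE conjE)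
  fix k n :: nat and x :: int
  assume *: "k > 0" "x > 0" "n > 2" "(2 ^ k - 1) * (3 ^ k - 1) = x ^ n"
  then have "n dvd k" by (intro dvd_exponent_of_le[of k n x n]) auto
  with * show False using not_perfect_power_if_dvd_exponent by blast
qed

end
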